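(* Let $N$ be a submodule of an $R$-module $M$ and $S$ a multiplicatively closed subset of $R$ with $Z(M)\cap S=\emptyset$. (1) If $N$ is a weakly $S$-prime submodule of $M$, then $S^{-1}N$ is a weakly prime submodule of $S^{-1}M$ (over $S^{-1}R$) and there exists $s\in S$ such that $(N:_{M}t)\subseteq(N:_{M}s)$ for all $t\in S$. (2) If $M$ is finitely generated, then the converse of (1) holds: if $S^{-1}N$ is a weakly prime submodule of $S^{-1}M$ and there exists $s\in S$ such that $(N:_{M}t)\subseteq(N:_{M}s)$ for all $t\in S$, then $N$ is a weakly $S$-prime submodule of $M$.
   Context: Rings are commutative with non-zero identity and modules are unital. A non-empty subset $S$ of $R$ is multiplicatively closed if it is closed under multiplication. $(N:_{R}M)=\{r\in R: rM\subseteq N\}$, $(N:_{M}t)=\{m\in M: tm\in N\}$, and $Z(M)=\{r\in R: rm=0\text{ for some } m\in M\setminus\{0_{M}\}\}$. A proper submodule $N$ of $M$ is weakly prime if for all $r\in R$, $m\in M$ with $0\neq rm\in N$, either $r\in(N:_{R}M)$ or $m\in N$. A submodule $N$ of $M$ with $(N:_{R}M)\cap S=\emptyset$ is weakly $S$-prime if there exists a fixed $s\in S$ such that for all $a\in R$, $m\in M$ with $0\neq am\in N$, either $sa\in(N:_{R}M)$ or $sm\in N$. *)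

theory Defs
  imports "HOL-Algebra.Module"
begin

section \<open>Colon ideals, zero divisors, weakly prime submodules\<close>

text \<open>The unit is not required to lie in the set.\<close>

definition mult_closed_subset :: "('a, 'r) ring_scheme \<Rightarrow> 'a set \<Rightarrow> bool" where
  "mult_closed_subset R S \<longleftrightarrow>
     S \<subseteq> carrier R \<and> S \<noteq> {} \<and> (\<forall>s\<in>S. \<forall>t\<in>S. s \<otimes>\<^bsub>R\<^esub> t \<in> S)"

definition colon_ring ::
  "('a, 'r) ring_scheme \<Rightarrow> ('a, 'b, 'm) module_scheme \<Rightarrow> 'b set \<Rightarrow> 'a set" where
  "colon_ring R M N = {r \<in> carrier R. \<forall>m\<in>carrier M. r \<odot>\<^bsub>M\<^esub> m \<in> N}"

definition colon_module :: "('a, 'b, 'm) module_scheme \<Rightarrow> 'b set \<Rightarrow> 'a \<Rightarrow> 'b set" where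
  "colon_module M N t = {m \<in> carrier M. t \<odot>\<^bsub>M\<^esub> m \<in> N}"

definition zero_divisors_on ::
  "('a, 'r) ring_scheme \<Rightarrow> ('a, 'b, 'm) module_scheme \<Rightarrow> 'a set" where
  "zero_divisors_on R M = {r \<in> carrier R. \<exists>m \<in> carrier M - {\<zero>\<^bsub>M\<^esub>}. r \<odot>\<^bsub>M\<^esub> m = \<zero>\<^bsub>M\<^esub>}"

definition finitely_generated_module ::
  "('a, 'r) ring_scheme \<Rightarrow> ('a, 'b, 'm) module_scheme \<Rightarrow> bool" where
  "finitely_generated_module R M \<longleftrightarrow>
     (\<exists>A. finite A \<and> A \<subseteq> carrier M \<and>
        (\<forall>m\<in>carrier M. \<exists>c \<in> A \<rightarrow> carrier R. m = (\<Oplus>\<^bsub>M\<^esub>x\<in>A. c x \<odot>\<^bsub>M\<^esub> x)))"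

definition weakly_prime_submodule ::
  "'b set \<Rightarrow> ('a, 'r) ring_scheme \<Rightarrow> ('a, 'b, 'm) module_scheme \<Rightarrow> bool" where
  "weakly_prime_submodule N R M \<longleftrightarrow>
     submodule N R M \<and> N \<noteq> carrier M \<and>
     (\<forall>r\<in>carrier R. \<forall>m\<in>carrier M.
        r \<odot>\<^bsub>M\<^esub> m \<noteq> \<zero>\<^bsub>M\<^esub> \<and> r \<odot>\<^bsub>M\<^esub> m \<in> N \<longrightarrow> r \<in> colon_ring R M N \<or> m \<in> N)"

definition weakly_S_prime_submodule ::
  "'a set \<Rightarrow> 'b set \<Rightarrow> ('a, 'r) ring_scheme \<Rightarrow> ('a, 'b, 'm) module_scheme \<Rightarrow> bool" where
  "weakly_S_prime_submodule S N R M \<longleftrightarrow>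
     submodule N R M \<and> colon_ring R M N \<inter> S = {} \<and>
     (\<exists>s\<in>S. \<forall>a\<in>carrier R. \<forall>m\<in>carrier M.
        a \<odot>\<^bsub>M\<^esub> m \<noteq> \<zero>\<^bsub>M\<^esub> \<and> a \<odot>\<^bsub>M\<^esub> m \<in> N \<longrightarrow>
        s \<otimes>\<^bsub>R\<^esub> a \<in> colon_ring R M N \<or> s \<odot>\<^bsub>M\<^esub> m \<in> N)"


section \<open>Localization\<close>

text \<open>
  The relation \<open>x/s = y/t \<longleftrightarrow> (\<exists>u\<in>S. u(tx) = u(sy))\<close> on \<open>A \<times> S\<close>, where \<open>S\<close> acts on
  \<open>A\<close> by \<open>act\<close>. It is used for \<open>A = carrier R\<close> with multiplication and for
  \<open>A = carrier M\<close> with scalar multiplication. Fractions are its equivalence classes.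
\<close>

definition frac_rel ::
  "'a set \<Rightarrow> 'b set \<Rightarrow> ('a \<Rightarrow> 'b \<Rightarrow> 'b) \<Rightarrow> (('b \<times> 'a) \<times> ('b \<times> 'a)) set" where
  "frac_rel S A act = {((x, s), (y, t)).
     x \<in> A \<and> s \<in> S \<and> y \<in> A \<and> t \<in> S \<and> (\<exists>u\<in>S. act u (act t x) = act u (act s y))}"

abbreviation ring_frac_rel ::
  "('a, 'r) ring_scheme \<Rightarrow> 'a set \<Rightarrow> (('a \<times> 'a) \<times> ('a \<times> 'a)) set" where
  "ring_frac_rel R S \<equiv> frac_rel S (carrier R) (mult R)"

abbreviation module_frac_rel ::
  "('a, 'b, 'm) module_scheme \<Rightarrow> 'a set \<Rightarrow> (('b \<times> 'a) \<times> ('b \<times> 'a)) set" where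
  "module_frac_rel M S \<equiv> frac_rel S (carrier M) (smult M)"

definition ring_frac :: "('a, 'r) ring_scheme \<Rightarrow> 'a set \<Rightarrow> 'a \<Rightarrow> 'a \<Rightarrow> ('a \<times> 'a) set" where
  "ring_frac R S a s = ring_frac_rel R S `` {(a, s)}"

definition module_frac ::
  "('a, 'b, 'm) module_scheme \<Rightarrow> 'a set \<Rightarrow> 'b \<Rightarrow> 'a \<Rightarrow> ('b \<times> 'a) set" where
  "module_frac M S x s = module_frac_rel M S `` {(x, s)}"

text \<open>
  The operations take the union over all representatives; these unions are single
  classes, as the lemmas \<open>add_frac\<close> etc. below show. As \<open>S\<close> need not contain the unit,
  one and zero are the common classes of the fractions \<open>s/s\<close> and \<open>0/s\<close>.
\<close>

definition loc_ring :: "('a, 'r) ring_scheme \<Rightarrow> 'a set \<Rightarrow> ('a \<times> 'a) set ring" where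
  "loc_ring R S = \<lparr>
     carrier = (carrier R \<times> S) // ring_frac_rel R S,
     mult = (\<lambda>X Y. \<Union>(a, s)\<in>X. \<Union>(b, t)\<in>Y. ring_frac R S (a \<otimes>\<^bsub>R\<^esub> b) (s \<otimes>\<^bsub>R\<^esub> t)),
     one = (\<Union>s\<in>S. ring_frac R S s s),
     zero = (\<Union>s\<in>S. ring_frac R S \<zero>\<^bsub>R\<^esub> s),
     add = (\<lambda>X Y. \<Union>(a, s)\<in>X. \<Union>(b, t)\<in>Y.
              ring_frac R S (t \<otimes>\<^bsub>R\<^esub> a \<oplus>\<^bsub>R\<^esub> s \<otimes>\<^bsub>R\<^esub> b) (s \<otimes>\<^bsub>R\<^esub> t))\<rparr>"

text \<open>The fields \<open>mult\<close> and \<open>one\<close> of a module record play no role in \<^locale>\<open>module\<close>.\<close>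

definition loc_module ::
  "('a, 'r) ring_scheme \<Rightarrow> ('a, 'b, 'm) module_scheme \<Rightarrow> 'a set \<Rightarrow>
     (('a \<times> 'a) set, ('b \<times> 'a) set) module" where
  "loc_module R M S = \<lparr>
     carrier = (carrier M \<times> S) // module_frac_rel M S,
     mult = undefined,
     one = undefined,
     zero = (\<Union>s\<in>S. module_frac M S \<zero>\<^bsub>M\<^esub> s),
     add = (\<lambda>X Y. \<Union>(x, s)\<in>X. \<Union>(y, t)\<in>Y.
              module_frac M S (t \<odot>\<^bsub>M\<^esub> x \<oplus>\<^bsub>M\<^esub> s \<odot>\<^bsub>M\<^esub> y) (s \<otimes>\<^bsub>R\<^esub> t)),
     smult = (\<lambda>X Y. \<Union>(a, s)\<in>X. \<Union>(x, t)\<in>Y. module_frac M S (a \<odot>\<^bsub>M\<^esub> x) (s \<otimes>\<^bsub>R\<^esub> t))\<rparr>"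

definition loc_submodule ::
  "('a, 'b, 'm) module_scheme \<Rightarrow> 'a set \<Rightarrow> 'b set \<Rightarrow> ('b \<times> 'a) set set" where
  "loc_submodule M S N = {module_frac M S n s | n s. n \<in> N \<and> s \<in> S}"


section \<open>The localizations are a ring and a module over it\<close>

definition ring_as_module :: "('a, 'r) ring_scheme \<Rightarrow> ('a, 'a) module" where
  "ring_as_module R = \<lparr>carrier = carrier R, mult = mult R, one = one R,
     zero = zero R, add = add R, smult = mult R\<rparr>"

locale module_localization = module +
  fixes S
  assumes mult_closed: "mult_closed_subset R S"
begin

lemma UN2_single:
  assumes "p \<in> X" "q \<in> Y"
    and "\<And>x s y t. (x, s) \<in> X \<Longrightarrow> (y, t) \<in> Y \<Longrightarrow> f x s y t = c"
  shows "(\<Union>(x, s)\<in>X. \<Union>(y, t)\<in>Y. f x s y t) = c"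
  using assms by (force split: prod.splits)

lemma S_carrier: "s \<in> S \<Longrightarrow> s \<in> carrier R"
  and S_mult: "s \<in> S \<Longrightarrow> t \<in> S \<Longrightarrow> s \<otimes> t \<in> S"
  and S_nonempty: "S \<noteq> {}"
  using mult_closed by (auto simp: mult_closed_subset_def)

lemma smult_left_commute:
  assumes "a \<in> carrier R" "b \<in> carrier R" "x \<in> carrier M"
  shows "a \<odot>\<^bsub>M\<^esub> (b \<odot>\<^bsub>M\<^esub> x) = b \<odot>\<^bsub>M\<^esub> (a \<odot>\<^bsub>M\<^esub> x)"
  using assms by (metis R.m_comm smult_assoc1)

lemma smult_zero: "a \<in> carrier R \<Longrightarrow> a \<odot>\<^bsub>M\<^esub> \<zero>\<^bsub>M\<^esub> = \<zero>\<^bsub>M\<^esub>"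
  by (metis M.add.l_cancel_one M.zero_closed smult_closed smult_r_distr M.l_zero)

lemmas smult_rules = smult_assoc1 smult_left_commute smult_r_distr S_carrier S_mult

lemma equiv_module_frac_rel: "equiv (carrier M \<times> S) (module_frac_rel M S)"
proof (rule equivI)
  show "module_frac_rel M S \<subseteq> (carrier M \<times> S) \<times> (carrier M \<times> S)"
    by (auto simp: frac_rel_def)
  show "refl_on (carrier M \<times> S) (module_frac_rel M S)"
    using S_nonempty by (auto simp: refl_on_def frac_rel_def ex_in_conv)
  show "sym (module_frac_rel M S)"
    by (clarsimp simp: sym_def frac_rel_def) metis
  show "trans (module_frac_rel M S)"
  proof (rule transI, clarsimp simp: frac_rel_def)
    fix x s y t z r u v
    assume S: "s \<in> S" "t \<in> S" "r \<in> S" "u \<in> S" "v \<in> S"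
      and C: "x \<in> carrier M" "y \<in> carrier M" "z \<in> carrier M"
      and eq: "u \<odot>\<^bsub>M\<^esub> (t \<odot>\<^bsub>M\<^esub> x) = u \<odot>\<^bsub>M\<^esub> (s \<odot>\<^bsub>M\<^esub> y)"
        "v \<odot>\<^bsub>M\<^esub> (r \<odot>\<^bsub>M\<^esub> y) = v \<odot>\<^bsub>M\<^esub> (t \<odot>\<^bsub>M\<^esub> z)"
    let ?w = "u \<otimes> (v \<otimes> t)"
    have "?w \<odot>\<^bsub>M\<^esub> (r \<odot>\<^bsub>M\<^esub> x) = v \<odot>\<^bsub>M\<^esub> (r \<odot>\<^bsub>M\<^esub> (u \<odot>\<^bsub>M\<^esub> (t \<odot>\<^bsub>M\<^esub> x)))"
      using S C by (simp add: smult_rules)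
    also have "\<dots> = u \<odot>\<^bsub>M\<^esub> (s \<odot>\<^bsub>M\<^esub> (v \<odot>\<^bsub>M\<^esub> (r \<odot>\<^bsub>M\<^esub> y)))"
      unfolding eq(1) using S C by (simp add: smult_rules)
    also have "\<dots> = ?w \<odot>\<^bsub>M\<^esub> (s \<odot>\<^bsub>M\<^esub> z)"
      unfolding eq(2) using S C by (simp add: smult_rules)
    finally show "\<exists>w\<in>S. w \<odot>\<^bsub>M\<^esub> (r \<odot>\<^bsub>M\<^esub> x) = w \<odot>\<^bsub>M\<^esub> (s \<odot>\<^bsub>M\<^esub> z)"
      using S S_mult by blast
  qed
qed

lemma frac_eq_iff:
  assumes "x \<in> carrier M" "y \<in> carrier M" "s \<in> S" "t \<in> S"
  shows "module_frac M S x s = module_frac M S y t \<longleftrightarrow>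
    (\<exists>u\<in>S. u \<odot>\<^bsub>M\<^esub> (t \<odot>\<^bsub>M\<^esub> x) = u \<odot>\<^bsub>M\<^esub> (s \<odot>\<^bsub>M\<^esub> y))"
proof -
  have "module_frac M S x s = module_frac M S y t \<longleftrightarrow> ((x, s), (y, t)) \<in> module_frac_rel M S"
    unfolding module_frac_def using assms
    by (intro eq_equiv_class_iff[OF equiv_module_frac_rel]) auto
  then show ?thesis using assms by (simp add: frac_rel_def)
qed

lemma mem_frac_iff:
  assumes "x \<in> carrier M" "s \<in> S"
  shows "(y, t) \<in> module_frac M S x s \<longleftrightarrow>
    y \<in> carrier M \<and> t \<in> S \<and> module_frac M S y t = module_frac M S x s"
proof -
  have "(y, t) \<in> module_frac M S x s \<longleftrightarrow> ((y, t), (x, s)) \<in> module_frac_rel M S"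
    using equiv_module_frac_rel unfolding module_frac_def equiv_def sym_def by blast
  then show ?thesis
    using assms frac_eq_iff[of y x t s] by (auto simp: frac_rel_def)
qed

lemma frac_self: "x \<in> carrier M \<Longrightarrow> s \<in> S \<Longrightarrow> (x, s) \<in> module_frac M S x s"
  by (simp add: mem_frac_iff)

lemma carrier_loc_module:
  "carrier (loc_module R M S) = {module_frac M S x s | x s. x \<in> carrier M \<and> s \<in> S}"
  by (auto simp: loc_module_def quotient_def module_frac_def)

lemma frac_eqI:
  assumes "x \<in> carrier M" "y \<in> carrier M" "s \<in> S" "t \<in> S"
    and "t \<odot>\<^bsub>M\<^esub> x = s \<odot>\<^bsub>M\<^esub> y"
  shows "module_frac M S x s = module_frac M S y t"
  using assms S_nonempty by (auto simp: frac_eq_iff)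

lemma zero_frac: "s \<in> S \<Longrightarrow> \<zero>\<^bsub>loc_module R M S\<^esub> = module_frac M S \<zero>\<^bsub>M\<^esub> s"
proof -
  assume s: "s \<in> S"
  have "module_frac M S \<zero>\<^bsub>M\<^esub> t = module_frac M S \<zero>\<^bsub>M\<^esub> s" if "t \<in> S" for t
    using s that by (intro frac_eqI) (simp_all add: smult_zero S_carrier)
  then show ?thesis using S_nonempty by (simp add: loc_module_def)
qed

lemma add_frac:
  assumes "x \<in> carrier M" "s \<in> S" "y \<in> carrier M" "t \<in> S"
  shows "module_frac M S x s \<oplus>\<^bsub>loc_module R M S\<^esub> module_frac M S y t =
    module_frac M S (t \<odot>\<^bsub>M\<^esub> x \<oplus>\<^bsub>M\<^esub> s \<odot>\<^bsub>M\<^esub> y) (s \<otimes> t)"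
proof -
  have "module_frac M S (t' \<odot>\<^bsub>M\<^esub> x' \<oplus>\<^bsub>M\<^esub> s' \<odot>\<^bsub>M\<^esub> y') (s' \<otimes> t') =
      module_frac M S (t \<odot>\<^bsub>M\<^esub> x \<oplus>\<^bsub>M\<^esub> s \<odot>\<^bsub>M\<^esub> y) (s \<otimes> t)"
    if x': "(x', s') \<in> module_frac M S x s" and y': "(y', t') \<in> module_frac M S y t"
    for x' s' y' t'
  proof -
    have C: "x' \<in> carrier M" "s' \<in> S" "y' \<in> carrier M" "t' \<in> S"
      using x' y' assms by (auto simp: mem_frac_iff)
    obtain u v where uv: "u \<in> S" "v \<in> S"
      and eq: "u \<odot>\<^bsub>M\<^esub> (s \<odot>\<^bsub>M\<^esub> x') = u \<odot>\<^bsub>M\<^esub> (s' \<odot>\<^bsub>M\<^esub> x)"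
        "v \<odot>\<^bsub>M\<^esub> (t \<odot>\<^bsub>M\<^esub> y') = v \<odot>\<^bsub>M\<^esub> (t' \<odot>\<^bsub>M\<^esub> y)"
      using x' y' assms C by (auto simp: mem_frac_iff frac_eq_iff)
    have "(u \<otimes> v) \<odot>\<^bsub>M\<^esub> ((s \<otimes> t) \<odot>\<^bsub>M\<^esub> (t' \<odot>\<^bsub>M\<^esub> x' \<oplus>\<^bsub>M\<^esub> s' \<odot>\<^bsub>M\<^esub> y')) =
        v \<odot>\<^bsub>M\<^esub> (t \<odot>\<^bsub>M\<^esub> (t' \<odot>\<^bsub>M\<^esub> (u \<odot>\<^bsub>M\<^esub> (s \<odot>\<^bsub>M\<^esub> x')))) \<oplus>\<^bsub>M\<^esub>
        u \<odot>\<^bsub>M\<^esub> (s \<odot>\<^bsub>M\<^esub> (s' \<odot>\<^bsub>M\<^esub> (v \<odot>\<^bsub>M\<^esub> (t \<odot>\<^bsub>M\<^esub> y'))))"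
      using assms C uv by (simp add: smult_rules)
    also have "\<dots> = (u \<otimes> v) \<odot>\<^bsub>M\<^esub> ((s' \<otimes> t') \<odot>\<^bsub>M\<^esub> (t \<odot>\<^bsub>M\<^esub> x \<oplus>\<^bsub>M\<^esub> s \<odot>\<^bsub>M\<^esub> y))"
      unfolding eq using assms C uv by (simp add: smult_rules)
    finally show ?thesis
      using assms C uv S_mult by (subst frac_eq_iff) (auto simp: S_carrier)
  qed
  from UN2_single[OF frac_self[OF assms(1,2)] frac_self[OF assms(3,4)] this]
  show ?thesis by (simp add: loc_module_def)
qed

lemma frac_closed:
  "x \<in> carrier M \<Longrightarrow> s \<in> S \<Longrightarrow> module_frac M S x s \<in> carrier (loc_module R M S)"
  by (auto simp: carrier_loc_module)

lemma loc_module_cases: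
  assumes "X \<in> carrier (loc_module R M S)"
  obtains x s where "x \<in> carrier M" "s \<in> S" "X = module_frac M S x s"
  using assms by (auto simp: carrier_loc_module)

lemma abelian_group_loc_module: "abelian_group (loc_module R M S)"
proof (rule abelian_groupI)
  let ?L = "loc_module R M S"
  obtain e where e: "e \<in> S" using S_nonempty by blast
  show "\<zero>\<^bsub>?L\<^esub> \<in> carrier ?L"
    using e by (simp add: zero_frac frac_closed)
  fix X assume "X \<in> carrier ?L"
  then obtain x s where X: "x \<in> carrier M" "s \<in> S" "X = module_frac M S x s"
    by (rule loc_module_cases)
  show "\<zero>\<^bsub>?L\<^esub> \<oplus>\<^bsub>?L\<^esub> X = X"
    unfolding zero_frac[OF X(2)] using X by (simp add: add_frac smult_zero S_carrier)
      (rule frac_eqI; simp add: smult_rules)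
  have "module_frac M S (\<ominus>\<^bsub>M\<^esub> x) s \<oplus>\<^bsub>?L\<^esub> X = \<zero>\<^bsub>?L\<^esub>"
    unfolding zero_frac[OF X(2)] using X
    by (simp add: add_frac S_carrier M.l_neg smult_zero flip: smult_r_distr)
      (rule frac_eqI; simp add: smult_zero S_carrier S_mult)
  then show "\<exists>Y\<in>carrier ?L. Y \<oplus>\<^bsub>?L\<^esub> X = \<zero>\<^bsub>?L\<^esub>"
    using X frac_closed M.a_inv_closed by blast
  fix Y assume "Y \<in> carrier ?L"
  then obtain y t where Y: "y \<in> carrier M" "t \<in> S" "Y = module_frac M S y t"
    by (rule loc_module_cases)
  show "X \<oplus>\<^bsub>?L\<^esub> Y \<in> carrier ?L"
    using X Y by (auto simp: add_frac smult_rules intro!: frac_closed)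
  show "X \<oplus>\<^bsub>?L\<^esub> Y = Y \<oplus>\<^bsub>?L\<^esub> X"
    using X Y by (simp add: add_frac S_carrier) (rule frac_eqI; simp add: smult_rules M.a_comm)
  fix Z assume "Z \<in> carrier ?L"
  then obtain z r where Z: "z \<in> carrier M" "r \<in> S" "Z = module_frac M S z r"
    by (rule loc_module_cases)
  show "X \<oplus>\<^bsub>?L\<^esub> Y \<oplus>\<^bsub>?L\<^esub> Z = X \<oplus>\<^bsub>?L\<^esub> (Y \<oplus>\<^bsub>?L\<^esub> Z)"
    using X Y Z by (simp add: add_frac S_carrier S_mult)
      (rule frac_eqI; simp add: smult_rules M.a_assoc)
qed

lemma module_ring_as_module: "module_localization R (ring_as_module R) S"
proof -
  have "abelian_group (ring_as_module R)"
  proof (rule abelian_groupI)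
    fix x assume "x \<in> carrier (ring_as_module R)"
    then show "\<exists>y\<in>carrier (ring_as_module R).
        y \<oplus>\<^bsub>ring_as_module R\<^esub> x = \<zero>\<^bsub>ring_as_module R\<^esub>"
      by (intro bexI[of _ "\<ominus> x"]) (auto simp: ring_as_module_def R.l_neg)
  qed (auto simp: ring_as_module_def R.a_ac)
  then have "module R (ring_as_module R)"
    by (rule moduleI[OF R.is_cring])
      (auto simp: ring_as_module_def R.l_distr R.r_distr R.m_assoc)
  then show ?thesis
    by (simp add: module_localization_def module_localization_axioms_def mult_closed)
qed

lemma module_frac_ring_as_module: "module_frac (ring_as_module R) S = ring_frac R S"
  by (simp add: fun_eq_iff module_frac_def ring_frac_def ring_as_module_def)

lemma smult_frac:
  assumes "a \<in> carrier R" "s \<in> S" "x \<in> carrier M" "t \<in> S"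
  shows "ring_frac R S a s \<odot>\<^bsub>loc_module R M S\<^esub> module_frac M S x t =
    module_frac M S (a \<odot>\<^bsub>M\<^esub> x) (s \<otimes> t)"
proof -
  interpret self: module_localization R "ring_as_module R" S
    by (rule module_ring_as_module)
  have "module_frac M S (a' \<odot>\<^bsub>M\<^esub> x') (s' \<otimes> t') = module_frac M S (a \<odot>\<^bsub>M\<^esub> x) (s \<otimes> t)"
    if a': "(a', s') \<in> ring_frac R S a s" and x': "(x', t') \<in> module_frac M S x t"
    for a' s' x' t'
  proof -
    have C: "x' \<in> carrier M" "t' \<in> S"
      using x' assms by (auto simp: mem_frac_iff)
    have a'': "a' \<in> carrier R \<and> s' \<in> S \<and> (\<exists>u\<in>S. u \<otimes> (s \<otimes> a') = u \<otimes> (s' \<otimes> a))"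
      using a' assms self.mem_frac_iff[of a s a' s'] self.frac_eq_iff[of a' a s' s]
      unfolding module_frac_ring_as_module by (auto simp: ring_as_module_def)
    obtain v where v: "v \<in> S" "v \<odot>\<^bsub>M\<^esub> (t \<odot>\<^bsub>M\<^esub> x') = v \<odot>\<^bsub>M\<^esub> (t' \<odot>\<^bsub>M\<^esub> x)"
      using x' assms C by (auto simp: mem_frac_iff frac_eq_iff)
    obtain u where u: "u \<in> S" "u \<otimes> (s \<otimes> a') = u \<otimes> (s' \<otimes> a)"
      using a'' by blast
    have A: "a' \<in> carrier R" "s' \<in> S" using a'' by auto
    have "(u \<otimes> v) \<odot>\<^bsub>M\<^esub> ((s \<otimes> t) \<odot>\<^bsub>M\<^esub> (a' \<odot>\<^bsub>M\<^esub> x')) =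
        (u \<otimes> (s \<otimes> a')) \<odot>\<^bsub>M\<^esub> (v \<odot>\<^bsub>M\<^esub> (t \<odot>\<^bsub>M\<^esub> x'))"
      using assms C A u(1) v(1) by (simp add: smult_rules)
    also have "\<dots> = (u \<otimes> v) \<odot>\<^bsub>M\<^esub> ((s' \<otimes> t') \<odot>\<^bsub>M\<^esub> (a \<odot>\<^bsub>M\<^esub> x))"
      unfolding u(2) v(2) using assms C A u(1) v(1) by (simp add: smult_rules)
    finally show ?thesis
      using assms C A u(1) v(1) S_mult by (subst frac_eq_iff) (auto simp: S_carrier)
  qed
  moreover have "(a, s) \<in> ring_frac R S a s"
    using self.frac_self[of a s] assms unfolding module_frac_ring_as_module
    by (simp add: ring_as_module_def)
  ultimately have "(\<Union>(a', s')\<in>ring_frac R S a s. \<Union>(x', t')\<in>module_frac M S x t.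
      module_frac M S (a' \<odot>\<^bsub>M\<^esub> x') (s' \<otimes> t')) = module_frac M S (a \<odot>\<^bsub>M\<^esub> x) (s \<otimes> t)"
    using frac_self[OF assms(3,4)] by (intro UN2_single)
  then show ?thesis by (simp add: loc_module_def)
qed

end

lemma loc_ring_eq_loc_module:
  "carrier (loc_ring R S) = carrier (loc_module R (ring_as_module R) S)"
  "add (loc_ring R S) = add (loc_module R (ring_as_module R) S)"
  "zero (loc_ring R S) = zero (loc_module R (ring_as_module R) S)"
  "mult (loc_ring R S) = smult (loc_module R (ring_as_module R) S)"
  by (simp_all add: loc_ring_def loc_module_def ring_as_module_def module_frac_def ring_frac_def)

context module_localization
begin

interpretation self: module_localization R "ring_as_module R" S
  by (rule module_ring_as_module)

lemma ring_as_module_simps: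
  "carrier (ring_as_module R) = carrier R" "zero (ring_as_module R) = zero R"
  "add (ring_as_module R) = add R" "smult (ring_as_module R) = mult R"
  by (simp_all add: ring_as_module_def)

lemmas ring_frac_eq_iff =
  self.frac_eq_iff[unfolded ring_as_module_simps module_frac_ring_as_module]
lemmas ring_frac_eqI =
  self.frac_eqI[unfolded ring_as_module_simps module_frac_ring_as_module]
lemmas ring_frac_closed =
  self.frac_closed[unfolded ring_as_module_simps module_frac_ring_as_module
    loc_ring_eq_loc_module[symmetric]]
lemmas loc_ring_cases =
  self.loc_module_cases[unfolded ring_as_module_simps module_frac_ring_as_module
    loc_ring_eq_loc_module[symmetric]]
lemmas zero_ring_frac =
  self.zero_frac[unfolded ring_as_module_simps module_frac_ring_as_module
    loc_ring_eq_loc_module[symmetric]]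
lemmas add_ring_frac =
  self.add_frac[unfolded ring_as_module_simps module_frac_ring_as_module
    loc_ring_eq_loc_module[symmetric]]
lemmas mult_ring_frac =
  self.smult_frac[unfolded ring_as_module_simps module_frac_ring_as_module
    loc_ring_eq_loc_module[symmetric]]

lemma one_ring_frac: "s \<in> S \<Longrightarrow> \<one>\<^bsub>loc_ring R S\<^esub> = ring_frac R S s s"
proof -
  assume s: "s \<in> S"
  have "ring_frac R S t t = ring_frac R S s s" if "t \<in> S" for t
    using s that by (intro ring_frac_eqI) (simp_all add: S_carrier R.m_comm)
  then show ?thesis using S_nonempty by (simp add: loc_ring_def)
qed

lemmas ring_rules = R.m_assoc R.m_comm R.m_lcomm R.l_distr R.r_distr S_carrier S_mult

lemma cring_loc_ring: "cring (loc_ring R S)"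
proof (rule cringI)
  let ?L = "loc_ring R S"
  obtain e where e: "e \<in> S" using S_nonempty by blast
  interpret A: abelian_group "loc_module R (ring_as_module R) S"
    by (rule self.abelian_group_loc_module)
  show "abelian_group ?L"
  proof (rule abelian_groupI; unfold loc_ring_eq_loc_module)
    fix X assume "X \<in> carrier (loc_module R (ring_as_module R) S)"
    then show "\<exists>Y\<in>carrier (loc_module R (ring_as_module R) S).
        Y \<oplus>\<^bsub>loc_module R (ring_as_module R) S\<^esub> X = \<zero>\<^bsub>loc_module R (ring_as_module R) S\<^esub>"
      using A.a_inv_closed A.l_neg by blast
  qed (simp_all add: A.a_assoc A.a_comm A.a_lcomm)
  show "comm_monoid ?L"
  proof (rule comm_monoidI)
    show "\<one>\<^bsub>?L\<^esub> \<in> carrier ?L"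
      using e by (simp add: one_ring_frac ring_frac_closed S_carrier)
    fix X assume "X \<in> carrier ?L"
    then obtain x s where X: "x \<in> carrier R" "s \<in> S" "X = ring_frac R S x s"
      by (rule loc_ring_cases)
    show "\<one>\<^bsub>?L\<^esub> \<otimes>\<^bsub>?L\<^esub> X = X"
      using X e by (simp add: one_ring_frac mult_ring_frac S_carrier)
        (rule ring_frac_eqI; simp add: ring_rules)
    fix Y assume "Y \<in> carrier ?L"
    then obtain y t where Y: "y \<in> carrier R" "t \<in> S" "Y = ring_frac R S y t"
      by (rule loc_ring_cases)
    show "X \<otimes>\<^bsub>?L\<^esub> Y \<in> carrier ?L"
      using X Y by (auto simp: mult_ring_frac S_mult intro!: ring_frac_closed)
    show "X \<otimes>\<^bsub>?L\<^esub> Y = Y \<otimes>\<^bsub>?L\<^esub> X"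
      using X Y by (simp add: mult_ring_frac R.m_comm S_carrier)
    fix Z assume "Z \<in> carrier ?L"
    then obtain z r where Z: "z \<in> carrier R" "r \<in> S" "Z = ring_frac R S z r"
      by (rule loc_ring_cases)
    show "X \<otimes>\<^bsub>?L\<^esub> Y \<otimes>\<^bsub>?L\<^esub> Z = X \<otimes>\<^bsub>?L\<^esub> (Y \<otimes>\<^bsub>?L\<^esub> Z)"
      using X Y Z by (simp add: mult_ring_frac S_mult) (simp add: R.m_assoc S_carrier)
  qed
  fix X Y Z assume "X \<in> carrier ?L" "Y \<in> carrier ?L" "Z \<in> carrier ?L"
  then obtain x s y t z r where X: "x \<in> carrier R" "s \<in> S" "X = ring_frac R S x s"
    and Y: "y \<in> carrier R" "t \<in> S" "Y = ring_frac R S y t"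
    and Z: "z \<in> carrier R" "r \<in> S" "Z = ring_frac R S z r"
    by (metis loc_ring_cases)
  show "(X \<oplus>\<^bsub>?L\<^esub> Y) \<otimes>\<^bsub>?L\<^esub> Z = X \<otimes>\<^bsub>?L\<^esub> Z \<oplus>\<^bsub>?L\<^esub> Y \<otimes>\<^bsub>?L\<^esub> Z"
    using X Y Z
    by (simp add: add_ring_frac mult_ring_frac S_carrier S_mult)
      (rule ring_frac_eqI; simp add: ring_rules)
qed

lemma module_loc_module: "module (loc_ring R S) (loc_module R M S)"
proof (rule moduleI[OF cring_loc_ring abelian_group_loc_module])
  let ?L = "loc_module R M S"
  let ?Q = "loc_ring R S"
  obtain e where e: "e \<in> S" using S_nonempty by blast
  fix X assume "X \<in> carrier ?L"
  then obtain x s where X: "x \<in> carrier M" "s \<in> S" "X = module_frac M S x s"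
    by (rule loc_module_cases)
  show "\<one>\<^bsub>?Q\<^esub> \<odot>\<^bsub>?L\<^esub> X = X"
    using X e by (simp add: one_ring_frac smult_frac S_carrier)
      (rule frac_eqI; simp add: smult_rules)
  fix A assume "A \<in> carrier ?Q"
  then obtain a t where A: "a \<in> carrier R" "t \<in> S" "A = ring_frac R S a t"
    by (rule loc_ring_cases)
  show "A \<odot>\<^bsub>?L\<^esub> X \<in> carrier ?L"
    using X A by (auto simp: smult_frac S_mult intro!: frac_closed)
  {
    fix B assume "B \<in> carrier ?Q"
    then obtain b r where B: "b \<in> carrier R" "r \<in> S" "B = ring_frac R S b r"
      by (rule loc_ring_cases)
    show "(A \<oplus>\<^bsub>?Q\<^esub> B) \<odot>\<^bsub>?L\<^esub> X = A \<odot>\<^bsub>?L\<^esub> X \<oplus>\<^bsub>?L\<^esub> B \<odot>\<^bsub>?L\<^esub> X"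
      using X A B
      by (simp add: add_ring_frac smult_frac add_frac S_carrier S_mult)
        (rule frac_eqI; simp add: smult_rules smult_l_distr)
    show "(A \<otimes>\<^bsub>?Q\<^esub> B) \<odot>\<^bsub>?L\<^esub> X = A \<odot>\<^bsub>?L\<^esub> (B \<odot>\<^bsub>?L\<^esub> X)"
      using X A B by (simp add: mult_ring_frac smult_frac S_carrier S_mult)
        (rule frac_eqI; simp add: smult_rules)
  }
  fix Y assume "Y \<in> carrier ?L"
  then obtain y r where Y: "y \<in> carrier M" "r \<in> S" "Y = module_frac M S y r"
    by (rule loc_module_cases)
  show "A \<odot>\<^bsub>?L\<^esub> (X \<oplus>\<^bsub>?L\<^esub> Y) = A \<odot>\<^bsub>?L\<^esub> X \<oplus>\<^bsub>?L\<^esub> A \<odot>\<^bsub>?L\<^esub> Y"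
    using X A Y by (simp add: smult_frac add_frac S_carrier S_mult)
      (rule frac_eqI; simp add: smult_rules)
qed

end

end

theory Submission
  imports Defs
begin

text \<open>
  Everything reduces to two observations. A fraction \<open>x/t\<close> lies in \<open>S\<^sup>-\<^sup>1N\<close> precisely when
  some \<open>u \<in> S\<close> moves the numerator into \<open>N\<close> (\<open>frac_mem_loc_submodule_iff\<close>). And since \<open>S\<close>
  contains no zero divisor on \<open>M\<close>, multiplication by an element of \<open>S\<close> is injective on \<open>M\<close>, so that
  the hypothesis \<open>0 \<noteq> am\<close> survives both the passage from \<open>M\<close> to \<open>S\<^sup>-\<^sup>1M\<close> and the clearing of
  denominators (\<open>frac_eq_zero_iff\<close>).

  Let \<open>N\<close> be weakly \<open>S\<close>-prime, with witness \<open>s\<close>. The crucial case is that of a scalar \<open>t \<in> S\<close>: if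
  \<open>tm \<in> N\<close>, then \<open>sm \<in> N\<close>, because the alternative \<open>st \<in> (N : M)\<close> contradicts
  \<open>(N : M) \<inter> S = {}\<close>. Hence \<open>s\<close> is the uniform denominator: \<open>(N : t) \<subseteq> (N : s)\<close> for all
  \<open>t \<in> S\<close>. In particular \<open>S\<^sup>-\<^sup>1N\<close> is proper, for otherwise \<open>sM \<subseteq> N\<close>. Given
  \<open>0 \<noteq> (a/u)(m/v) \<in> S\<^sup>-\<^sup>1N\<close>, some \<open>w \<in> S\<close> satisfies \<open>0 \<noteq> a(wm) \<in> N\<close>, and each of the
  outcomes \<open>sa \<in> (N : M)\<close> and \<open>swm \<in> N\<close> localizes.

  Conversely, a uniform denominator \<open>s\<close> turns membership of a fraction \<open>x/t\<close> in \<open>S\<^sup>-\<^sup>1N\<close> into the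
  single condition \<open>sx \<in> N\<close>. If \<open>0 \<noteq> am \<in> N\<close>, weak primeness of \<open>S\<^sup>-\<^sup>1N\<close> applied to \<open>a/s\<close> and
  \<open>m/s\<close> gives \<open>sm \<in> N\<close>, or \<open>s(ax) \<in> N\<close> for every \<open>x \<in> M\<close>, that is \<open>sa \<in> (N : M)\<close>.
\<close>

section \<open>Localizing a submodule\<close>

locale submodule_localization = module_localization +
  fixes N
  assumes submodule_N: "submodule N R M"
begin

lemma N_carrier: "x \<in> N \<Longrightarrow> x \<in> carrier M"
  using submoduleE(1)[OF submodule_N] by blast

lemma N_zero: "\<zero>\<^bsub>M\<^esub> \<in> N"
  using subgroup.one_closed[OF submodule.axioms(1)[OF submodule_N]] by simp

lemma N_add: "x \<in> N \<Longrightarrow> y \<in> N \<Longrightarrow> x \<oplus>\<^bsub>M\<^esub> y \<in> N"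
  by (rule submoduleE(5)[OF submodule_N])

lemma N_smult: "a \<in> carrier R \<Longrightarrow> x \<in> N \<Longrightarrow> a \<odot>\<^bsub>M\<^esub> x \<in> N"
  by (rule submoduleE(4)[OF submodule_N])

lemma frac_mem_loc_submodule: "n \<in> N \<Longrightarrow> s \<in> S \<Longrightarrow> module_frac M S n s \<in> loc_submodule M S N"
  by (auto simp: loc_submodule_def)

text \<open>
  Equality of fractions \<open>x/t = n/s\<close> means \<open>u(sx) = u(tn)\<close> for some \<open>u \<in> S\<close>, so \<open>us\<close> moves \<open>x\<close>
  into \<open>N\<close>; conversely \<open>x/t = (ux)/(ut)\<close>.
\<close>

lemma frac_mem_loc_submodule_iff:
  assumes x: "x \<in> carrier M" and t: "t \<in> S"
  shows "module_frac M S x t \<in> loc_submodule M S N \<longleftrightarrow> (\<exists>u\<in>S. u \<odot>\<^bsub>M\<^esub> x \<in> N)"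
proof
  assume "module_frac M S x t \<in> loc_submodule M S N"
  then obtain n s where n: "n \<in> N" "s \<in> S" "module_frac M S x t = module_frac M S n s"
    by (auto simp: loc_submodule_def)
  then obtain u where u: "u \<in> S" "u \<odot>\<^bsub>M\<^esub> (s \<odot>\<^bsub>M\<^esub> x) = u \<odot>\<^bsub>M\<^esub> (t \<odot>\<^bsub>M\<^esub> n)"
    using x t by (auto simp: frac_eq_iff N_carrier)
  have "(u \<otimes> s) \<odot>\<^bsub>M\<^esub> x = u \<odot>\<^bsub>M\<^esub> (t \<odot>\<^bsub>M\<^esub> n)"
    using u n x by (simp add: smult_assoc1 S_carrier)
  moreover have "u \<odot>\<^bsub>M\<^esub> (t \<odot>\<^bsub>M\<^esub> n) \<in> N"
    using u n t by (simp add: N_smult S_carrier)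
  ultimately show "\<exists>u\<in>S. u \<odot>\<^bsub>M\<^esub> x \<in> N"
    using S_mult[OF u(1) n(2)] by metis
next
  assume "\<exists>u\<in>S. u \<odot>\<^bsub>M\<^esub> x \<in> N"
  then obtain u where u: "u \<in> S" "u \<odot>\<^bsub>M\<^esub> x \<in> N" by blast
  have "module_frac M S x t = module_frac M S (u \<odot>\<^bsub>M\<^esub> x) (u \<otimes> t)"
    using x t u by (intro frac_eqI) (simp_all add: smult_rules)
  then show "module_frac M S x t \<in> loc_submodule M S N"
    using u t by (simp add: frac_mem_loc_submodule S_mult)
qed

lemma loc_submodule_subset: "loc_submodule M S N \<subseteq> carrier (loc_module R M S)"
  by (auto simp: loc_submodule_def N_carrier frac_closed)

lemma smult_mem_loc_submodule:
  assumes "A \<in> carrier (loc_ring R S)" "X \<in> loc_submodule M S N"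
  shows "A \<odot>\<^bsub>loc_module R M S\<^esub> X \<in> loc_submodule M S N"
proof -
  obtain a s where A: "a \<in> carrier R" "s \<in> S" "A = ring_frac R S a s"
    using assms(1) by (rule loc_ring_cases)
  obtain n t where X: "n \<in> N" "t \<in> S" "X = module_frac M S n t"
    using assms(2) by (auto simp: loc_submodule_def)
  have "A \<odot>\<^bsub>loc_module R M S\<^esub> X = module_frac M S (a \<odot>\<^bsub>M\<^esub> n) (s \<otimes> t)"
    using A X by (simp add: smult_frac N_carrier)
  then show ?thesis
    using A X by (simp add: frac_mem_loc_submodule N_smult S_mult)
qed

lemma submodule_loc_submodule:
  "submodule (loc_submodule M S N) (loc_ring R S) (loc_module R M S)"
proof -
  interpret L: module "loc_ring R S" "loc_module R M S"
    by (rule module_loc_module)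
  show ?thesis
  proof (rule L.submoduleI)
    obtain e where "e \<in> S" using S_nonempty by blast
    then show "\<zero>\<^bsub>loc_module R M S\<^esub> \<in> loc_submodule M S N"
      by (simp add: zero_frac frac_mem_loc_submodule N_zero)
  next
    fix X assume X: "X \<in> loc_submodule M S N"
    then have XC: "X \<in> carrier (loc_module R M S)" using loc_submodule_subset by blast
    have "\<ominus>\<^bsub>loc_module R M S\<^esub> X =
        (\<ominus>\<^bsub>loc_ring R S\<^esub> \<one>\<^bsub>loc_ring R S\<^esub>) \<odot>\<^bsub>loc_module R M S\<^esub> X"
      using XC by (simp add: L.smult_l_minus)
    then show "\<ominus>\<^bsub>loc_module R M S\<^esub> X \<in> loc_submodule M S N"
      using X smult_mem_loc_submodule by simp
  next
    fix X Y assume "X \<in> loc_submodule M S N" "Y \<in> loc_submodule M S N"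
    then obtain x s y t where "x \<in> N" "s \<in> S" "X = module_frac M S x s"
      "y \<in> N" "t \<in> S" "Y = module_frac M S y t"
      by (auto simp: loc_submodule_def)
    then have "X \<oplus>\<^bsub>loc_module R M S\<^esub> Y =
        module_frac M S (t \<odot>\<^bsub>M\<^esub> x \<oplus>\<^bsub>M\<^esub> s \<odot>\<^bsub>M\<^esub> y) (s \<otimes> t) \<and>
        t \<odot>\<^bsub>M\<^esub> x \<oplus>\<^bsub>M\<^esub> s \<odot>\<^bsub>M\<^esub> y \<in> N \<and> s \<otimes> t \<in> S"
      by (simp add: add_frac N_carrier N_add N_smult S_carrier S_mult)
    then show "X \<oplus>\<^bsub>loc_module R M S\<^esub> Y \<in> loc_submodule M S N"
      by (simp add: frac_mem_loc_submodule)
  qed (use loc_submodule_subset smult_mem_loc_submodule in auto)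
qed

end

section \<open>Weakly prime submodules of the localization\<close>

locale regular_submodule_localization = submodule_localization +
  assumes zero_divisors_disjoint: "zero_divisors_on R M \<inter> S = {}"
begin

lemma smult_eq_zero_iff:
  assumes "u \<in> S" "x \<in> carrier M"
  shows "u \<odot>\<^bsub>M\<^esub> x = \<zero>\<^bsub>M\<^esub> \<longleftrightarrow> x = \<zero>\<^bsub>M\<^esub>"
  using assms zero_divisors_disjoint S_carrier[of u]
  by (auto simp: zero_divisors_on_def smult_zero)

lemma frac_eq_zero_iff:
  assumes x: "x \<in> carrier M" and t: "t \<in> S"
  shows "module_frac M S x t = \<zero>\<^bsub>loc_module R M S\<^esub> \<longleftrightarrow> x = \<zero>\<^bsub>M\<^esub>"
  unfolding zero_frac[OF t] using assms S_nonempty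
  by (auto simp: frac_eq_iff smult_zero S_carrier smult_eq_zero_iff)

text \<open>
  For a scalar \<open>t \<in> S\<close> the first alternative of weak \<open>S\<close>-primeness would put \<open>st \<in> S\<close> into
  \<open>(N : M)\<close>.
\<close>

lemma uniform_colon_if_weakly_S_prime:
  assumes disj: "colon_ring R M N \<inter> S = {}" and s: "s \<in> S"
    and weak: "\<And>a m. a \<in> carrier R \<Longrightarrow> m \<in> carrier M \<Longrightarrow> a \<odot>\<^bsub>M\<^esub> m \<noteq> \<zero>\<^bsub>M\<^esub> \<Longrightarrow>
      a \<odot>\<^bsub>M\<^esub> m \<in> N \<Longrightarrow> s \<otimes> a \<in> colon_ring R M N \<or> s \<odot>\<^bsub>M\<^esub> m \<in> N"
    and t: "t \<in> S"
  shows "colon_module M N t \<subseteq> colon_module M N s"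
proof
  fix m assume "m \<in> colon_module M N t"
  then have m: "m \<in> carrier M" "t \<odot>\<^bsub>M\<^esub> m \<in> N" by (auto simp: colon_module_def)
  have "s \<odot>\<^bsub>M\<^esub> m \<in> N"
  proof (cases "m = \<zero>\<^bsub>M\<^esub>")
    case True
    then show ?thesis using s by (simp add: smult_zero S_carrier N_zero)
  next
    case False
    moreover have "s \<otimes> t \<notin> colon_ring R M N" using disj s t S_mult by blast
    ultimately show ?thesis using weak[of t m] m t by (auto simp: smult_eq_zero_iff S_carrier)
  qed
  then show "m \<in> colon_module M N s" using m by (simp add: colon_module_def)
qed

text \<open>
  The element \<open>w\<close> that clears the denominators of \<open>(a/u)(m/v) \<in> S\<^sup>-\<^sup>1N\<close> is absorbed into \<open>m\<close>, not
  into \<open>a\<close>: the alternatives are then \<open>sa \<in> (N : M)\<close>, which puts \<open>a/u\<close> into the colon ideal of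
  \<open>S\<^sup>-\<^sup>1N\<close>, and \<open>(sw)m \<in> N\<close>, which puts \<open>m/v\<close> into \<open>S\<^sup>-\<^sup>1N\<close>.
\<close>

lemma weakly_prime_loc_submodule_if_weakly_S_prime:
  assumes disj: "colon_ring R M N \<inter> S = {}" and s: "s \<in> S"
    and weak: "\<And>a m. a \<in> carrier R \<Longrightarrow> m \<in> carrier M \<Longrightarrow> a \<odot>\<^bsub>M\<^esub> m \<noteq> \<zero>\<^bsub>M\<^esub> \<Longrightarrow>
      a \<odot>\<^bsub>M\<^esub> m \<in> N \<Longrightarrow> s \<otimes> a \<in> colon_ring R M N \<or> s \<odot>\<^bsub>M\<^esub> m \<in> N"
  shows "weakly_prime_submodule (loc_submodule M S N) (loc_ring R S) (loc_module R M S)"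
  unfolding weakly_prime_submodule_def
proof (intro conjI ballI impI)
  let ?L = "loc_module R M S" and ?Q = "loc_ring R S" and ?K = "loc_submodule M S N"
  show "submodule ?K ?Q ?L" by (rule submodule_loc_submodule)
  show "?K \<noteq> carrier ?L"
  proof
    assume eq: "?K = carrier ?L"
    have "s \<odot>\<^bsub>M\<^esub> m \<in> N" if m: "m \<in> carrier M" for m
    proof -
      obtain u where "u \<in> S" "u \<odot>\<^bsub>M\<^esub> m \<in> N"
        using frac_closed[OF m s] m s unfolding eq[symmetric]
        by (auto simp: frac_mem_loc_submodule_iff)
      then show ?thesis
        using uniform_colon_if_weakly_S_prime[OF disj s weak, of u] m
        by (auto simp: colon_module_def)
    qed
    then have "s \<in> colon_ring R M N" using s by (simp add: colon_ring_def S_carrier)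
    then show False using disj s by blast
  qed
  fix A X assume AC: "A \<in> carrier ?Q" and XC: "X \<in> carrier ?L"
    and AX: "A \<odot>\<^bsub>?L\<^esub> X \<noteq> \<zero>\<^bsub>?L\<^esub> \<and> A \<odot>\<^bsub>?L\<^esub> X \<in> ?K"
  obtain a u where A: "a \<in> carrier R" "u \<in> S" "A = ring_frac R S a u"
    using AC by (rule loc_ring_cases)
  obtain m v where X: "m \<in> carrier M" "v \<in> S" "X = module_frac M S m v"
    using XC by (rule loc_module_cases)
  have am: "a \<odot>\<^bsub>M\<^esub> m \<noteq> \<zero>\<^bsub>M\<^esub>" "\<exists>w\<in>S. w \<odot>\<^bsub>M\<^esub> (a \<odot>\<^bsub>M\<^esub> m) \<in> N"
    using AX A X
    by (auto simp: smult_frac frac_eq_zero_iff frac_mem_loc_submodule_iff S_mult)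
  then obtain w where w: "w \<in> S" "w \<odot>\<^bsub>M\<^esub> (a \<odot>\<^bsub>M\<^esub> m) \<in> N" by blast
  have aw: "a \<odot>\<^bsub>M\<^esub> (w \<odot>\<^bsub>M\<^esub> m) = w \<odot>\<^bsub>M\<^esub> (a \<odot>\<^bsub>M\<^esub> m)"
    using A X w by (intro smult_left_commute) (simp_all add: S_carrier)
  have "a \<odot>\<^bsub>M\<^esub> (w \<odot>\<^bsub>M\<^esub> m) \<noteq> \<zero>\<^bsub>M\<^esub>"
    unfolding aw using am A X w by (simp add: smult_eq_zero_iff)
  moreover have "a \<odot>\<^bsub>M\<^esub> (w \<odot>\<^bsub>M\<^esub> m) \<in> N" using w aw by simp
  ultimately consider "s \<otimes> a \<in> colon_ring R M N" | "s \<odot>\<^bsub>M\<^esub> (w \<odot>\<^bsub>M\<^esub> m) \<in> N"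
    using weak[of a "w \<odot>\<^bsub>M\<^esub> m"] A X w by (auto simp: S_carrier)
  then show "A \<in> colon_ring ?Q ?L ?K \<or> X \<in> ?K"
  proof cases
    case 1
    have "A \<odot>\<^bsub>?L\<^esub> Y \<in> ?K" if YC: "Y \<in> carrier ?L" for Y
    proof -
      obtain y r where Y: "y \<in> carrier M" "r \<in> S" "Y = module_frac M S y r"
        using YC by (rule loc_module_cases)
      have "s \<odot>\<^bsub>M\<^esub> (a \<odot>\<^bsub>M\<^esub> y) \<in> N"
        using 1 Y A s by (simp add: colon_ring_def smult_assoc1 S_carrier)
      then show ?thesis
        using A Y s by (auto simp: smult_frac frac_mem_loc_submodule_iff S_mult)
    qed
    then show ?thesis using AC by (simp add: colon_ring_def)
  next
    case 2
    then have "(s \<otimes> w) \<odot>\<^bsub>M\<^esub> m \<in> N" using X w s by (simp add: smult_assoc1 S_carrier)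
    then have "X \<in> ?K" using X w s S_mult by (auto simp: frac_mem_loc_submodule_iff)
    then show ?thesis ..
  qed
qed

text \<open>
  The elements of \<open>S\<close> that clear the denominators of the fractions \<open>(a/s)(x/s) \<in> S\<^sup>-\<^sup>1N\<close> depend
  on \<open>x\<close>; the inclusions \<open>(N : t) \<subseteq> (N : s)\<close> replace them all by \<open>s\<close>.
\<close>

lemma weakly_S_prime_if_weakly_prime_loc_submodule:
  assumes prime: "weakly_prime_submodule (loc_submodule M S N) (loc_ring R S) (loc_module R M S)"
    and s: "s \<in> S" and uniform: "\<And>t. t \<in> S \<Longrightarrow> colon_module M N t \<subseteq> colon_module M N s"
  shows "weakly_S_prime_submodule S N R M"
  unfolding weakly_S_prime_submodule_def
proof (intro conjI bexI[OF _ s] ballI impI)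
  let ?L = "loc_module R M S" and ?Q = "loc_ring R S" and ?K = "loc_submodule M S N"
  have frac_mem: "module_frac M S x t \<in> ?K \<longleftrightarrow> s \<odot>\<^bsub>M\<^esub> x \<in> N"
    if "x \<in> carrier M" "t \<in> S" for x t
    using that s uniform by (auto simp: frac_mem_loc_submodule_iff colon_module_def)
  show "submodule N R M" by (rule submodule_N)
  \<comment> \<open>A scalar \<open>r \<in> S\<close> with \<open>rM \<subseteq> N\<close> would move every numerator into \<open>N\<close>.\<close>
  show "colon_ring R M N \<inter> S = {}"
  proof (rule ccontr)
    assume "colon_ring R M N \<inter> S \<noteq> {}"
    then obtain r where "r \<in> S" "\<And>m. m \<in> carrier M \<Longrightarrow> r \<odot>\<^bsub>M\<^esub> m \<in> N"
      by (auto simp: colon_ring_def)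
    then have "carrier ?L \<subseteq> ?K"
      by (fastforce simp: carrier_loc_module frac_mem_loc_submodule_iff)
    then show False
      using prime loc_submodule_subset by (auto simp: weakly_prime_submodule_def)
  qed
  fix a m assume a: "a \<in> carrier R" and m: "m \<in> carrier M"
    and am: "a \<odot>\<^bsub>M\<^esub> m \<noteq> \<zero>\<^bsub>M\<^esub> \<and> a \<odot>\<^bsub>M\<^esub> m \<in> N"
  let ?A = "ring_frac R S a s"
  \<comment> \<open>Since \<open>S\<close> need not contain the unit, \<open>a\<close> and \<open>m\<close> are represented by fractions over \<open>s\<close>.\<close>
  have prod: "?A \<odot>\<^bsub>?L\<^esub> module_frac M S x s = module_frac M S (a \<odot>\<^bsub>M\<^esub> x) (s \<otimes> s)"
    if "x \<in> carrier M" for x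
    using that a s by (simp add: smult_frac)
  have "?A \<odot>\<^bsub>?L\<^esub> module_frac M S m s \<noteq> \<zero>\<^bsub>?L\<^esub>"
    using am a m s by (simp add: prod frac_eq_zero_iff S_mult)
  moreover have "?A \<odot>\<^bsub>?L\<^esub> module_frac M S m s \<in> ?K"
    using am a m s by (simp add: prod frac_mem S_mult N_smult S_carrier)
  ultimately consider "?A \<in> colon_ring ?Q ?L ?K" | "module_frac M S m s \<in> ?K"
    using prime ring_frac_closed[OF a s] frac_closed[OF m s]
    unfolding weakly_prime_submodule_def by blast
  then show "s \<otimes> a \<in> colon_ring R M N \<or> s \<odot>\<^bsub>M\<^esub> m \<in> N"
  proof cases
    case 1
    have "(s \<otimes> a) \<odot>\<^bsub>M\<^esub> x \<in> N" if x: "x \<in> carrier M" for x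
    proof -
      have "?A \<odot>\<^bsub>?L\<^esub> module_frac M S x s \<in> ?K"
        using 1 frac_closed[OF x s] by (simp add: colon_ring_def)
      then show ?thesis
        using x a s by (simp add: prod frac_mem S_mult smult_assoc1 S_carrier)
    qed
    then show ?thesis using a s by (simp add: colon_ring_def S_carrier)
  next
    case 2
    then show ?thesis using m s by (simp add: frac_mem)
  qed
qed

end

theorem proposition4:
  fixes R :: "('a, 'r) ring_scheme" and M :: "('a, 'b, 'm) module_scheme"
    and N :: "'b set" and S :: "'a set"
  assumes "module R M"
    and "\<one>\<^bsub>R\<^esub> \<noteq> \<zero>\<^bsub>R\<^esub>"
    and "submodule N R M"
    and "mult_closed_subset R S"
    and "zero_divisors_on R M \<inter> S = {}"
  shows "(weakly_S_prime_submodule S N R M \<longrightarrow>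
           weakly_prime_submodule (loc_submodule M S N) (loc_ring R S) (loc_module R M S) \<and>
           (\<exists>s\<in>S. \<forall>t\<in>S. colon_module M N t \<subseteq> colon_module M N s)) \<and>
         (finitely_generated_module R M \<longrightarrow>
           weakly_prime_submodule (loc_submodule M S N) (loc_ring R S) (loc_module R M S) \<and>
           (\<exists>s\<in>S. \<forall>t\<in>S. colon_module M N t \<subseteq> colon_module M N s) \<longrightarrow>
           weakly_S_prime_submodule S N R M)"
proof -
  interpret module R M by fact
  interpret regular_submodule_localization R M S N
    by (intro_locales; intro module_localization_axioms.intro submodule_localization_axioms.intro
        regular_submodule_localization_axioms.intro; fact)
  show ?thesis
  proof (rule conjI; intro impI)
    assume "weakly_S_prime_submodule S N R M"
    then obtain s where disj: "colon_ring R M N \<inter> S = {}" and s: "s \<in> S"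
      and weak: "\<And>a m. a \<in> carrier R \<Longrightarrow> m \<in> carrier M \<Longrightarrow> a \<odot>\<^bsub>M\<^esub> m \<noteq> \<zero>\<^bsub>M\<^esub> \<Longrightarrow>
        a \<odot>\<^bsub>M\<^esub> m \<in> N \<Longrightarrow> s \<otimes>\<^bsub>R\<^esub> a \<in> colon_ring R M N \<or> s \<odot>\<^bsub>M\<^esub> m \<in> N"
      unfolding weakly_S_prime_submodule_def by blast
    show "weakly_prime_submodule (loc_submodule M S N) (loc_ring R S) (loc_module R M S) \<and>
        (\<exists>s\<in>S. \<forall>t\<in>S. colon_module M N t \<subseteq> colon_module M N s)"
      using weakly_prime_loc_submodule_if_weakly_S_prime[OF disj s weak]
        uniform_colon_if_weakly_S_prime[OF disj s weak] s by blast
  next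
    assume "weakly_prime_submodule (loc_submodule M S N) (loc_ring R S) (loc_module R M S) \<and>
      (\<exists>s\<in>S. \<forall>t\<in>S. colon_module M N t \<subseteq> colon_module M N s)"
    then show "weakly_S_prime_submodule S N R M"
      using weakly_S_prime_if_weakly_prime_loc_submodule by blast
  qed
qed

end
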